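(* Let $G$ be a connected graph with $p$ vertices and $q$ edges that satisfies property $(\dagger)$. Then $W_\epsilon(\overline{G})=2q$.
   Context: Graphs are finite, simple, undirected. For a connected graph $H$ with vertices $v_1,\ldots,v_n$, $d(v_i,v_j)$ is the distance and $e(v_i)=\max_j d(v_i,v_j)$ the eccentricity. The eccentricity matrix $\epsilon(H)$ has $(i,j)$ entry $d(v_i,v_j)$ if $d(v_i,v_j)=\min\{e(v_i),e(v_j)\}$ and $0$ otherwise. The eccentricity Wiener index is $W_\epsilon(H)=\frac12\sum_{i,j}(\epsilon(H))_{ij}$. $\overline{G}$ is the complement of $G$. A graph satisfies property $(\dagger)$ if for any two adjacent vertices $u,v$ there is a third vertex $w$ adjacent to neither $u$ nor $v$. *)

theory Defs
  imports "Graph_Theory.Graph_Theory"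
begin

text \<open>
  A finite simple undirected graph is a \<open>pair_graph\<close>: a finite, symmetric, loop-free digraph whose
  arcs are pairs of vertices, the undirected edge \<open>uv\<close> being the two arcs \<open>(u,v)\<close> and \<open>(v,u)\<close>.
\<close>

definition edges :: "'a pair_pre_digraph \<Rightarrow> 'a set set" where
  "edges G = (\<lambda>(u, v). {u, v}) ` parcs G"

definition graph_complement :: "'a pair_pre_digraph \<Rightarrow> 'a pair_pre_digraph" where
  "graph_complement G =
     \<lparr> pverts = pverts G,
       parcs = {(u, v). u \<in> pverts G \<and> v \<in> pverts G \<and> u \<noteq> v \<and> (u, v) \<notin> parcs G} \<rparr>"

lemma (in pair_graph) pair_graph_graph_complement: "pair_graph (graph_complement G)"
proof
  show "finite (parcs (graph_complement G))"
    by (rule finite_subset[of _ "pverts G \<times> pverts G"])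
       (auto simp: graph_complement_def pair_finite_verts)
  have "(u, v) \<in> parcs G \<Longrightarrow> (v, u) \<in> parcs G" for u v
    using pair_sym_arcs by (auto simp: symmetric_def sym_def)
  then show "symmetric (graph_complement G)"
    by (auto simp: symmetric_def sym_def graph_complement_def)
qed (auto simp: graph_complement_def pair_finite_verts)

text \<open>
  The least length of a walk, i.e. the library's shortest-path distance for unit weights. That
  distance is infinite between different components, and \<open>real_of_ereal\<close> then returns \<open>0\<close>; so
  this and the three notions below are meaningful for connected graphs only.
\<close>

definition graph_dist :: "'a pair_pre_digraph \<Rightarrow> 'a \<Rightarrow> 'a \<Rightarrow> real" where
  "graph_dist H u v = real_of_ereal (wf_digraph.\<mu> (with_proj H) (\<lambda>_. 1) u v)"

definition eccentricity :: "'a pair_pre_digraph \<Rightarrow> 'a \<Rightarrow> real" where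
  "eccentricity H u = Max (graph_dist H u ` pverts H)"

text \<open>Matrices are indexed by the vertices themselves rather than by an enumeration of them.\<close>

definition eccentricity_matrix :: "'a pair_pre_digraph \<Rightarrow> 'a \<Rightarrow> 'a \<Rightarrow> real" where
  "eccentricity_matrix H u v =
     (if graph_dist H u v = min (eccentricity H u) (eccentricity H v) then graph_dist H u v else 0)"

definition eccentricity_wiener_index :: "'a pair_pre_digraph \<Rightarrow> real" where
  "eccentricity_wiener_index H =
     1 / 2 * (\<Sum>u\<in>pverts H. \<Sum>v\<in>pverts H. eccentricity_matrix H u v)"

definition dagger_property :: "'a pair_pre_digraph \<Rightarrow> bool" where
  "dagger_property G \<longleftrightarrow>
     (\<forall>u v. (u, v) \<in> parcs G \<longrightarrow>
        (\<exists>w\<in>pverts G. w \<noteq> u \<and> w \<noteq> v \<and> (w, u) \<notin> parcs G \<and> (w, v) \<notin> parcs G))"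

end

theory Submission
  imports Defs
begin

text \<open>
  Vertices that are distinct and non-adjacent in \<open>G\<close> are at distance 1 in the complement, while
  property \<open>(\<dagger>)\<close> puts the ends of an edge of \<open>G\<close> at distance 2. If \<open>G\<close> has an edge, then by
  connectedness every vertex lies on one, so all eccentricities in the complement are 2 and the
  eccentricity matrix of the complement is twice the adjacency matrix of \<open>G\<close>.
\<close>

lemma (in wf_digraph) awalk_cost_unit: "awalk_cost (\<lambda>_. 1) p = real (length p)"
  by (induction p) auto

text \<open>With unit weights the cost of a walk is its length, so a walk no longer than any other
  attains the infimum defining \<open>\<mu>\<close>. The value is finite, hence
  \<open>real_of_ereal\<close> preserves it.\<close>

lemma (in pair_wf_digraph) graph_dist_eqI:
  assumes "awalk u p v" and "\<And>p'. awalk u p' v \<Longrightarrow> length p \<le> length p'"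
  shows "graph_dist G u v = real (length p)"
proof -
  have "\<mu> (\<lambda>_. 1) u v = ereal (real (length p))"
    unfolding \<mu>_def awalk_cost_unit
    by (rule antisym) (use assms in \<open>auto intro: INF_lower2 INF_greatest\<close>)
  then show ?thesis
    by (simp add: graph_dist_def)
qed

lemma (in pair_wf_digraph) graph_dist_self:
  "u \<in> pverts G \<Longrightarrow> graph_dist G u u = 0"
  using graph_dist_eqI[of u "[]" u] by (simp add: awalk_Nil_iff)

lemma (in pair_wf_digraph) graph_dist_adjacent:
  assumes "(u, v) \<in> parcs G" "u \<noteq> v"
  shows "graph_dist G u v = 1"
proof -
  have "awalk u [(u, v)] v"
    using assms by (auto simp: awalk_simps intro: wellformed')
  moreover have "length [(u, v)] \<le> length p" if "awalk u p v" for p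
    using that assms by (cases p) (auto simp: awalk_Nil_iff)
  ultimately show ?thesis
    using graph_dist_eqI by fastforce
qed

lemma (in pair_wf_digraph) graph_dist_two:
  assumes "(u, w) \<in> parcs G" "(w, v) \<in> parcs G" "(u, v) \<notin> parcs G" "u \<noteq> v"
  shows "graph_dist G u v = 2"
proof -
  have "awalk u [(u, w), (w, v)] v"
    using assms by (auto simp: awalk_simps intro: wellformed')
  moreover have "length [(u, w), (w, v)] \<le> length p" if "awalk u p v" for p
  proof (cases p)
    case (Cons a p')
    \<comment> \<open>If \<open>p'\<close> were empty, the single arc of \<open>p\<close> would be
      \<open>(u, v)\<close>.\<close>
    then show ?thesis
      using that assms by (cases a; cases p') (auto simp: awalk_simps)
  qed (use that assms in \<open>auto simp: awalk_Nil_iff\<close>)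
  ultimately show ?thesis
    using graph_dist_eqI by fastforce
qed

text \<open>The map from arcs to edges has fibres of size two: symmetry supplies the reversed arc,
  and the absence of loops makes it a different one.\<close>

lemma (in pair_graph) card_parcs: "card (parcs G) = 2 * card (edges G)"
proof -
  have fiber: "card {a \<in> parcs G. (case a of (u, v) \<Rightarrow> {u, v}) = e} = 2"
    if e: "e \<in> edges G" for e
  proof -
    obtain u v where uv: "(u, v) \<in> parcs G" "e = {u, v}"
      using e by (auto simp: edges_def)
    have ends: "(case a of (x, y) \<Rightarrow> {x, y}) = e \<longleftrightarrow> a = (u, v) \<or> a = (v, u)" for a
      by (cases a) (simp add: uv(2) doubleton_eq_iff)
    have "{a \<in> parcs G. (case a of (u, v) \<Rightarrow> {u, v}) = e} = {(u, v), (v, u)}"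
      unfolding ends using uv(1) arcs_symmetric[OF uv(1)] by auto
    then show ?thesis
      using no_loops'[OF uv(1)] by simp
  qed
  have "card (parcs G) =
      (\<Sum>e\<in>edges G. card {a \<in> parcs G. (case a of (u, v) \<Rightarrow> {u, v}) = e})"
    using sum.image_gen[OF pair_finite_arcs, of "\<lambda>_. 1::nat" "\<lambda>(u, v). {u, v}"]
    by (simp add: edges_def)
  also have "\<dots> = 2 * card (edges G)"
    using fiber by simp
  finally show ?thesis .
qed

text \<open>The first arc of a walk from \<open>u\<close> to \<open>v\<close> leads to a neighbour.
  Connectedness is stated for the symmetric closure, which has the same reachability as the
  symmetric \<open>G\<close>.\<close>

lemma (in pair_sym_digraph) connected_imp_neighbour:
  assumes "Digraph_Component.connected (with_proj G)" "u \<in> pverts G" "v \<in> pverts G" "u \<noteq> v"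
  shows "\<exists>w. (u, w) \<in> parcs G"
proof -
  have "u \<rightarrow>\<^sup>*\<^bsub>mk_symmetric (with_proj G)\<^esub> v"
    using assms by (auto simp: connected_def strongly_connected_def)
  then have "u \<rightarrow>\<^sup>*\<^bsub>with_proj G\<^esub> v"
    using reachable_mk_symmetric_eq[OF pair_sym_arcs] by simp
  then show ?thesis
    using \<open>u \<noteq> v\<close> by (cases rule: converse_reachable_cases) auto
qed

lemma (in pair_graph) graph_dist_complement:
  assumes "dagger_property G" "u \<in> pverts G" "v \<in> pverts G"
  shows "graph_dist (graph_complement G) u v =
    (if u = v then 0 else if (u, v) \<in> parcs G then 2 else 1)"
proof -
  interpret C: pair_graph "graph_complement G"
    by (rule pair_graph_graph_complement)
  show ?thesis
  proof (cases "(u, v) \<in> parcs G")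
    case True
    then obtain w where "w \<in> pverts G" "w \<noteq> u" "w \<noteq> v" "(w, u) \<notin> parcs G" "(w, v) \<notin> parcs G"
      using assms(1) unfolding dagger_property_def by blast
    \<comment> \<open>In the complement, \<open>w\<close> is a common neighbour of \<open>u\<close>
      and \<open>v\<close>; symmetry turns \<open>(w, u) \<notin> parcs G\<close> into the
      orientation \<open>(u, w)\<close> of the path \<open>u\<close>, \<open>w\<close>,
      \<open>v\<close>.\<close>
    then show ?thesis
      using True no_loops'[OF True] assms(2,3) arcs_symmetric[of u w] C.graph_dist_two[of u w v]
      by (auto simp: graph_complement_def)
  next
    case False
    then show ?thesis
      using assms(2,3) C.graph_dist_self[of v] C.graph_dist_adjacent[of u v]
      by (auto simp: graph_complement_def)
  qed
qed

text \<open>An unreachable pair has infinite \<open>\<mu>\<close>, which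
  \<open>real_of_ereal\<close> sends to 0, whereas \<open>graph_dist_complement\<close> gives 1 or 2
  for distinct vertices.\<close>

lemma (in pair_graph) connected_graph_complement:
  assumes "dagger_property G" "pverts G \<noteq> {}"
  shows "Digraph_Component.connected (with_proj (graph_complement G))"
proof -
  interpret C: pair_graph "graph_complement G"
    by (rule pair_graph_graph_complement)
  have "u \<rightarrow>\<^sup>*\<^bsub>with_proj (graph_complement G)\<^esub> v" if uv: "u \<in> pverts G" "v \<in> pverts G" for u v
  proof (cases "u = v")
    case True
    then show ?thesis
      using uv C.reachable_refl[of v] by (simp add: graph_complement_def)
  next
    case False
    show ?thesis
    proof (rule ccontr)
      assume "\<not> u \<rightarrow>\<^sup>*\<^bsub>with_proj (graph_complement G)\<^esub> v"
      then have "graph_dist (graph_complement G) u v = 0"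
        by (simp add: graph_dist_def C.shortest_path_inf)
      then show False
        using False graph_dist_complement[OF assms(1) uv] by (simp split: if_splits)
    qed
  qed
  then show ?thesis
    using assms(2) C.reachable_mk_symmetric_eq[OF C.pair_sym_arcs]
    by (simp add: connected_def strongly_connected_def graph_complement_def)
qed

text \<open>All distances in the complement are at most 2, and the neighbour \<open>w\<close> of
  \<open>u\<close> in \<open>G\<close> attains this bound.\<close>

lemma (in pair_graph) eccentricity_complement:
  assumes "dagger_property G" "(u, w) \<in> parcs G"
  shows "eccentricity (graph_complement G) u = 2"
  unfolding eccentricity_def
proof (rule Max_eqI)
  note dist = graph_dist_complement[OF assms(1)]
  have verts: "pverts (graph_complement G) = pverts G" "u \<in> pverts G" "w \<in> pverts G"
    using assms(2) by (auto simp: graph_complement_def intro: wellformed')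
  show "finite (graph_dist (graph_complement G) u ` pverts (graph_complement G))"
    using verts pair_finite_verts by simp
  show "y \<le> 2" if "y \<in> graph_dist (graph_complement G) u ` pverts (graph_complement G)" for y
    using that verts dist by auto
  have "graph_dist (graph_complement G) u w = 2"
    using dist verts assms(2) no_loops' by auto
  then show "2 \<in> graph_dist (graph_complement G) u ` pverts (graph_complement G)"
    using verts by force
qed

lemma (in pair_graph) eccentricity_matrix_complement:
  assumes "Digraph_Component.connected (with_proj G)" "dagger_property G"
    and "u \<in> pverts G" "v \<in> pverts G"
  shows "eccentricity_matrix (graph_complement G) u v = (if (u, v) \<in> parcs G then 2 else 0)"
proof (cases "u = v")
  \<comment> \<open>On the diagonal the distance is 0, so both branches of the matrix definition
    give 0; this covers the one-vertex graph, where the eccentricity is 0 rather than 2.\<close>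
  case True
  then show ?thesis
    using no_loops'[of v v] graph_dist_complement[OF assms(2-4)]
    by (auto simp: eccentricity_matrix_def)
next
  case False
  \<comment> \<open>Each of the distinct vertices \<open>u\<close>, \<open>v\<close> serves as the
    other's target, so both have neighbours in \<open>G\<close> and hence eccentricity 2 in the
    complement: exactly the entries with distance 2 survive.\<close>
  then obtain w w' where "(u, w) \<in> parcs G" "(v, w') \<in> parcs G"
    using connected_imp_neighbour assms by metis
  then show ?thesis
    using False graph_dist_complement[OF assms(2-4)] eccentricity_complement[OF assms(2)]
    by (auto simp: eccentricity_matrix_def)
qed

theorem theorem4p2:
  fixes G :: "'a pair_pre_digraph" and p q :: nat
  assumes "pair_graph G"
    and "Digraph_Component.connected (with_proj G)"
    and "card (pverts G) = p"
    and "card (edges G) = q"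
    and "dagger_property G"
  shows "Digraph_Component.connected (with_proj (graph_complement G))
    \<and> eccentricity_wiener_index (graph_complement G) = 2 * real q"
proof
  interpret pair_graph G by fact
  \<comment> \<open>Strong connectivity includes nonemptiness of the vertex set.\<close>
  have "pverts G \<noteq> {}"
    using assms(2) by (simp add: connected_def strongly_connected_def)
  with assms(5) show "Digraph_Component.connected (with_proj (graph_complement G))"
    by (rule connected_graph_complement)
  have "(\<Sum>u\<in>pverts G. \<Sum>v\<in>pverts G. eccentricity_matrix (graph_complement G) u v) =
      (\<Sum>a\<in>pverts G \<times> pverts G. if a \<in> parcs G then 2 else 0)"
    using eccentricity_matrix_complement[OF assms(2,5)]
    by (simp add: sum.cartesian_product' cong: sum.cong)
  also have "\<dots> = (\<Sum>a\<in>(pverts G \<times> pverts G) \<inter> parcs G. 2)"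
    using pair_finite_verts by (intro sum.inter_restrict[symmetric]) simp
  also have "(pverts G \<times> pverts G) \<inter> parcs G = parcs G"
    by (auto intro: wellformed')
  \<comment> \<open>Each of the \<open>2 * q\<close> arcs contributes 2; the factor 1/2 in the index
    then leaves \<open>2 * q\<close>.\<close>
  also have "(\<Sum>a\<in>parcs G. 2 :: real) = 4 * real q"
    using card_parcs assms(4) by simp
  finally show "eccentricity_wiener_index (graph_complement G) = 2 * real q"
    by (simp add: eccentricity_wiener_index_def graph_complement_def)
qed

end
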